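(* Let $\mathcal X\subseteq\mathbb R^d$ be convex and compact with $\|x\|_\infty\le1$ for all $x\in\mathcal X$, and let $\Phi$ be a set of linear transformations with $\phi(\mathcal X)\subseteq\mathcal X$ for all $\phi\in\Phi$. Let $\mathcal R_\Phi$ be a regret minimizer for $\Phi$ that is $(A,B)$-predictive with respect to $\|\cdot\|_1$ and fixed point $\kappa$-stable with respect to $\|\cdot\|_1$. Then, given access to a stable fixed point oracle, one can construct a $\kappa$-stable algorithm (outputting $x^{(t)}\in\mathcal X$ with $\|x^{(t)}-x^{(t-1)}\|_1\le\kappa$ for all $t\ge2$) whose $\Phi$-regret $$\mathrm{Reg}^T=\max_{\phi^*\in\Phi}\sum_{t=1}^T\langle\phi^*(x^{(t)}),\ell^{(t)}\rangle-\sum_{t=1}^T\langle x^{(t)},\ell^{(t)}\rangle$$ satisfies, for every sequence of utility vectors $\ell^{(1)},\dots,\ell^{(T)}\in\mathbb R^d$ with $\|\ell^{(t)}\|_\infty\le\|\ell\|_\infty$ for all $t\geq 1$ (where $\|\ell\|_\infty$ denotes a fixed upper bound), $$\mathrm{Reg}^T\le A+2B\sum_{t=1}^T\|\ell^{(t)}-\ell^{(t-1)}\|_\infty^2+2B\|\ell\|_\infty^2\sum_{t=1}^T\|x^{(t)}-x^{(t-1)}\|_\infty^2+\|\ell\|_\infty\sum_{t=1}^T\epsilon^{(t)},$$ where $\epsilon^{(t)}$ is the error of the stable fixed point oracle at time $t$.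
   Context: **Regret minimizers.** A regret minimizer for a set $\mathcal Y$ of vectors outputs, at each time $t$, a point $y^{(t)}\in\mathcal Y$ depending only on previously observed utilities, and then observes a utility vector $L^{(t)}$ (which may depend adversarially on previous outputs). Its (external) regret is $\max_{y^*\in\mathcal Y}\sum_{t\le T}\langle y^*,L^{(t)}\rangle-\sum_{t\le T}\langle y^{(t)},L^{(t)}\rangle$. It is $(A,B)$-predictive with respect to $\|\cdot\|_1$ if, for every sequence of utilities, its regret is at most $A+B\sum_{t=1}^T\|L^{(t)}-L^{(t-1)}\|_\infty^2$, with $L^{(0)}=0$ (the prediction at time $t$ is the previous utility). Linear transformations $\phi\in\Phi$ are identified with the vectors of entries of their $d\times d$ matrices, and utilities on $\Phi$ with vectors in $\mathbb R^{d\times d}$. Conventions: $\ell^{(0)}=0$ and $x^{(0)}=x^{(1)}$. **Fixed point stability.** $\mathcal R_\Phi$, producing the sequence $(\phi^{(t)})$, is fixed point $\kappa$-stable with respect to $\|\cdot\|$ if every $\phi^{(t)}$ has a fixed point in $\mathcal X$, and for every $x^{(t)}\in\mathcal X$ with $x^{(t)}=\phi^{(t)}(x^{(t)})$ there is $x^{(t+1)}\in\mathcal X$ with $x^{(t+1)}=\phi^{(t+1)}(x^{(t+1)})$ and $\|x^{(t+1)}-x^{(t)}\|\le\kappa$. **Stable fixed point oracle.** A call with input $(\phi;\tilde x,\kappa,\epsilon)$ returns $x\in\mathcal X$ with $\|\phi(x)-x\|_1\le\epsilon$ and $\|x-\tilde x\|_1\le\kappa$. It is assumed available for the calls with $\phi=\phi^{(t)}$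 and $\tilde x=x^{(t-1)}$ (the previous output) and error $\epsilon=\epsilon^{(t)}$, for all $t\ge2$; at $t=1$ only the condition $\|\phi^{(1)}(x^{(1)})-x^{(1)}\|_1\le\epsilon^{(1)}$ is required. *)

theory Defs
  imports "HOL-Analysis.Analysis"
begin

text \<open>
  The \<open>\<ell>\<^sub>\<infinity>\<close> norm is \<^const>\<open>infnorm\<close>; on matrices \<open>real^'n^'n\<close> it is the largest absolute value of an
  entry, and the inner product there is the entrywise one.
\<close>

definition l1norm :: "real ^ 'n \<Rightarrow> real" where
  "l1norm x = (\<Sum>i\<in>UNIV. \<bar>x $ i\<bar>)"

text \<open>
  An online algorithm is a function from the list of utilities observed so far, oldest first, to
  the next output. Time starts at 1: a sequence \<open>L\<close> of utilities is read from \<open>L 1\<close> on, and \<open>L 0\<close>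
  is only used for the convention \<open>L 0 = 0\<close>.
\<close>

type_synonym ('u, 'y) online = "'u list \<Rightarrow> 'y"

text \<open>Note \<open>play R L 0 = play R L 1 = R []\<close>, which is the convention \<open>x\<^sup>0 = x\<^sup>1\<close>.\<close>

definition play :: "('u, 'y) online \<Rightarrow> (nat \<Rightarrow> 'u) \<Rightarrow> nat \<Rightarrow> 'y" where
  "play R L t = R (map L [1..<t])"

definition regret_minimizer :: "'a set \<Rightarrow> ('a, 'a) online \<Rightarrow> bool" where
  "regret_minimizer Y R \<longleftrightarrow> (\<forall>h. R h \<in> Y)"

text \<open>
  The maximum is taken as a supremum in the extended reals, so that it is meaningful also when
  it is not attained or infinite (\<open>Y\<close> is not assumed to be compact).
\<close>

definition regret :: "'a::real_inner set \<Rightarrow> (nat \<Rightarrow> 'a) \<Rightarrow> (nat \<Rightarrow> 'a) \<Rightarrow> nat \<Rightarrow> ereal" where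
  "regret Y y L T =
     (SUP y'\<in>Y. ereal (\<Sum>t=1..T. y' \<bullet> L t)) - ereal (\<Sum>t=1..T. y t \<bullet> L t)"

definition predictive ::
  "'a::euclidean_space set \<Rightarrow> real \<Rightarrow> real \<Rightarrow> ('a, 'a) online \<Rightarrow> bool" where
  "predictive Y A B R \<longleftrightarrow>
     (\<forall>L T. L 0 = 0 \<longrightarrow>
        regret Y (play R L) L T \<le> ereal (A + B * (\<Sum>t=1..T. (infnorm (L t - L (t - 1)))\<^sup>2)))"

definition phi_regret ::
  "(real ^ 'n ^ 'n) set \<Rightarrow> (nat \<Rightarrow> real ^ 'n) \<Rightarrow> (nat \<Rightarrow> real ^ 'n) \<Rightarrow> nat \<Rightarrow> ereal" where
  "phi_regret \<Phi> x l T =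
     (SUP \<phi>\<in>\<Phi>. ereal (\<Sum>t=1..T. (\<phi> *v x t) \<bullet> l t)) - ereal (\<Sum>t=1..T. x t \<bullet> l t)"

definition fixed_point_stable ::
  "(real ^ 'n) set \<Rightarrow> (real ^ 'n \<Rightarrow> real) \<Rightarrow> real \<Rightarrow> (nat \<Rightarrow> real ^ 'n ^ 'n) \<Rightarrow> bool" where
  "fixed_point_stable X nrm \<kappa> \<phi> \<longleftrightarrow>
     (\<forall>t\<ge>1. (\<exists>x\<in>X. \<phi> t *v x = x) \<and>
        (\<forall>x\<in>X. x = \<phi> t *v x \<longrightarrow>
           (\<exists>x'\<in>X. x' = \<phi> (t + 1) *v x' \<and> nrm (x' - x) \<le> \<kappa>)))"

definition oracle_answer ::
  "(real ^ 'n) set \<Rightarrow> real ^ 'n ^ 'n \<Rightarrow> real ^ 'n \<Rightarrow> real \<Rightarrow> real \<Rightarrow> real ^ 'n \<Rightarrow> bool" where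
  "oracle_answer X \<phi> x' \<kappa> \<epsilon> x \<longleftrightarrow>
     x \<in> X \<and> l1norm (\<phi> *v x - x) \<le> \<epsilon> \<and> l1norm (x - x') \<le> \<kappa>"

text \<open>
  The matrix of the linear utility \<open>\<phi> \<mapsto> \<langle>\<phi>(x), l\<rangle>\<close> on linear transformations.
\<close>

definition utility_matrix :: "real ^ 'n \<Rightarrow> real ^ 'n \<Rightarrow> real ^ 'n ^ 'n" where
  "utility_matrix x l = (\<chi> i j. l $ i * x $ j)"

lemma inner_utility_matrix: "\<phi> \<bullet> utility_matrix x l = (\<phi> *v x) \<bullet> l"
  by (simp add: utility_matrix_def inner_vec_def matrix_vector_mult_def sum_distrib_left
      sum_distrib_right mult_ac)

text \<open>
  \<open>transformations R x l t\<close> is the transformation \<open>\<phi>\<^sup>t\<close> chosen by \<open>R\<close> at time \<open>t\<close> when, at each earlier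
  time \<open>s\<close>, it has observed the utility \<open>\<phi> \<mapsto> \<langle>\<phi>(x s), l s\<rangle>\<close>.
\<close>

definition transformations ::
  "(real ^ 'n ^ 'n, real ^ 'n ^ 'n) online \<Rightarrow> (nat \<Rightarrow> real ^ 'n) \<Rightarrow> (nat \<Rightarrow> real ^ 'n)
     \<Rightarrow> nat \<Rightarrow> real ^ 'n ^ 'n" where
  "transformations R x l = play R (\<lambda>s. utility_matrix (x s) (l s))"

text \<open>
  \<open>x\<close> starts at \<open>x1\<close> and from time 2 on consists of the answers of the oracle \<open>orc\<close> to the
  calls \<open>(\<phi>\<^sup>t; x (t - 1), \<kappa>, \<epsilon> t)\<close>. Nothing is said here about these answers being correct.
\<close>

definition oracle_run ::
  "(real ^ 'n ^ 'n, real ^ 'n ^ 'n) online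
     \<Rightarrow> (real ^ 'n ^ 'n \<Rightarrow> real ^ 'n \<Rightarrow> real \<Rightarrow> real \<Rightarrow> real ^ 'n)
     \<Rightarrow> real ^ 'n \<Rightarrow> real \<Rightarrow> (nat \<Rightarrow> real)
     \<Rightarrow> (nat \<Rightarrow> real ^ 'n) \<Rightarrow> (nat \<Rightarrow> real ^ 'n) \<Rightarrow> bool" where
  "oracle_run R orc x1 \<kappa> \<epsilon> l x \<longleftrightarrow>
     x 1 = x1 \<and> (\<forall>t\<ge>2. x t = orc (transformations R x l t) (x (t - 1)) \<kappa> (\<epsilon> t))"

definition bounded_utilities :: "real \<Rightarrow> (nat \<Rightarrow> 'a::euclidean_space) \<Rightarrow> bool" where
  "bounded_utilities M l \<longleftrightarrow> l 0 = 0 \<and> (\<forall>t\<ge>1. infnorm (l t) \<le> M)"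

end

theory Submission
  imports Defs
begin

text \<open>
  Run \<open>R\<close> on the utilities \<open>\<phi> \<mapsto> \<langle>\<phi>(x\<^sup>t), l\<^sup>t\<rangle>\<close> and play the oracle's answers. The \<open>\<Phi>\<close>-regret is the
  regret of \<open>R\<close> plus \<open>\<Sum> \<langle>\<phi>\<^sup>t(x\<^sup>t) - x\<^sup>t, l\<^sup>t\<rangle>\<close>, and the latter is at most \<open>M \<Sum> \<epsilon>\<^sup>t\<close> by Hoelder's
  inequality. The variation of the utilities of \<open>R\<close> splits, entry by entry, as
  \<open>l\<^sub>i x\<^sub>j - l'\<^sub>i x'\<^sub>j = (l - l')\<^sub>i x\<^sub>j + l'\<^sub>i (x - x')\<^sub>j\<close>, and squaring costs the factor 2.
\<close>

lemma infnorm_nth_le: "\<bar>x $ i\<bar> \<le> infnorm x" for x :: "real ^ 'n"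
  using Basis_le_infnorm[of "axis i 1" x] by (simp add: inner_axis axis_in_Basis_iff)

lemma infnorm_le:
  fixes x :: "'a::euclidean_space"
  assumes "\<And>b. b \<in> Basis \<Longrightarrow> \<bar>x \<bullet> b\<bar> \<le> c"
  shows "infnorm x \<le> c"
  using assms by (simp add: infnorm_Max)

lemma infnorm_matrix_le:
  fixes A :: "real ^ 'n ^ 'm"
  assumes "\<And>i j. \<bar>A $ i $ j\<bar> \<le> c"
  shows "infnorm A \<le> c"
proof (rule infnorm_le)
  fix b :: "real ^ 'n ^ 'm" assume "b \<in> Basis"
  \<comment> \<open>Basis matrices have a single entry 1, so the inner product with one of them
    reads off an entry.\<close>
  then obtain i j where "b = axis i (axis j 1)"
    by (auto simp: Basis_vec_def)
  then show "\<bar>A \<bullet> b\<bar> \<le> c"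
    using assms by (simp add: inner_axis)
qed

lemma inner_le_l1norm_infnorm: "x \<bullet> y \<le> l1norm x * infnorm y" for x y :: "real ^ 'n"
proof -
  have "x $ i * y $ i \<le> \<bar>x $ i\<bar> * infnorm y" for i
  proof -
    have "x $ i * y $ i \<le> \<bar>x $ i\<bar> * \<bar>y $ i\<bar>"
      by (metis abs_ge_self abs_mult)
    also have "\<dots> \<le> \<bar>x $ i\<bar> * infnorm y"
      by (intro mult_left_mono infnorm_nth_le) auto
    finally show ?thesis .
  qed
  then show ?thesis
    by (simp add: inner_vec_def l1norm_def sum_distrib_right sum_mono)
qed

lemma l1norm_nonneg: "0 \<le> l1norm x"
  by (simp add: l1norm_def sum_nonneg)

text \<open>The intermediate product pairs \<open>l'\<close> with \<open>x\<close>; what remains to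
  be bounded is thus the norm of the current point and that of the previous utility.\<close>

lemma infnorm_utility_matrix_diff_le:
  "infnorm (utility_matrix x l - utility_matrix x' l')
     \<le> infnorm (l - l') * infnorm x + infnorm l' * infnorm (x - x')"
proof (rule infnorm_matrix_le)
  fix i j
  have "(utility_matrix x l - utility_matrix x' l') $ i $ j
      = (l - l') $ i * x $ j + l' $ i * (x - x') $ j"
    by (simp add: utility_matrix_def algebra_simps)
  also have "\<bar>\<dots>\<bar> \<le> \<bar>(l - l') $ i\<bar> * \<bar>x $ j\<bar> + \<bar>l' $ i\<bar> * \<bar>(x - x') $ j\<bar>"
    by (metis abs_mult abs_triangle_ineq)
  also have "\<dots> \<le> infnorm (l - l') * infnorm x + infnorm l' * infnorm (x - x')"
    by (intro add_mono mult_mono infnorm_nth_le infnorm_pos_le abs_ge_zero)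
  finally show "\<bar>(utility_matrix x l - utility_matrix x' l') $ i $ j\<bar>
      \<le> infnorm (l - l') * infnorm x + infnorm l' * infnorm (x - x')" .
qed

lemma infnorm_utility_matrix_diff_squared_le:
  assumes "infnorm x \<le> 1" "infnorm l' \<le> M"
  shows "(infnorm (utility_matrix x l - utility_matrix x' l'))\<^sup>2
     \<le> 2 * (infnorm (l - l'))\<^sup>2 + 2 * M\<^sup>2 * (infnorm (x - x'))\<^sup>2"
proof -
  let ?a = "infnorm (l - l')" and ?b = "M * infnorm (x - x')"
  have "infnorm (l - l') * infnorm x + infnorm l' * infnorm (x - x') \<le> ?a * 1 + ?b"
    using assms by (intro add_mono mult_left_mono mult_right_mono infnorm_pos_le)
  with infnorm_utility_matrix_diff_le[of x l x' l']
  have "(infnorm (utility_matrix x l - utility_matrix x' l'))\<^sup>2 \<le> (?a + ?b)\<^sup>2"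
    by (intro power_mono infnorm_pos_le) simp
  also have "\<dots> \<le> 2 * ?a\<^sup>2 + 2 * ?b\<^sup>2"
    using sum_squares_bound[of ?a ?b] by (simp add: power2_sum)
  finally show ?thesis
    by (simp add: power_mult_distrib)
qed

text \<open>
  For a single round and the comparator \<open>R []\<close> the regret is nonnegative, however large the
  utility is.
\<close>

lemma predictive_imp_nonneg:
  assumes "regret_minimizer Y R" "predictive Y A B R"
  shows "0 \<le> B"
proof (rule ccontr)
  assume "\<not> 0 \<le> B"
  obtain b :: 'a where b: "b \<in> Basis"
    using nonempty_Basis by blast
  \<comment> \<open>The constant makes \<open>B * c = B - (\<bar>A\<bar> + 1)\<close>, hence
    \<open>A + B * c < 0\<close>. The summand 1 gives \<open>1 \<le> c\<close>, so that
    \<open>c\<close> is dominated by the squared norm of \<open>c *\<^sub>R b\<close>.\<close>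
  define c where "c = (\<bar>A\<bar> + 1) / - B + 1"
  define L where "L t = (if t = 0 then 0 else c *\<^sub>R b)" for t :: nat
  have "1 \<le> c"
    using \<open>\<not> 0 \<le> B\<close> by (simp add: c_def divide_nonneg_neg)
  have "infnorm b \<ge> 1"
    using Basis_le_infnorm[OF b, of b] b by simp
  then have c: "c \<le> infnorm (c *\<^sub>R b)"
    using \<open>1 \<le> c\<close> mult_left_mono[of 1 "infnorm b" c] by (simp add: infnorm_mul)
  also have "\<dots> \<le> (infnorm (c *\<^sub>R b))\<^sup>2"
    using \<open>1 \<le> c\<close> c by (intro self_le_power) auto
  finally have "c \<le> (infnorm (c *\<^sub>R b))\<^sup>2" .
  then have "B * (infnorm (c *\<^sub>R b))\<^sup>2 \<le> B * c"
    using \<open>\<not> 0 \<le> B\<close> by (intro mult_left_mono_neg) auto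
  moreover have "B * c = B - (\<bar>A\<bar> + 1)"
    using \<open>\<not> 0 \<le> B\<close> by (simp add: c_def field_simps)
  ultimately have neg: "A + B * (infnorm (c *\<^sub>R b))\<^sup>2 < 0"
    using \<open>\<not> 0 \<le> B\<close> by linarith
  have "ereal (R [] \<bullet> (c *\<^sub>R b)) \<le> (SUP y'\<in>Y. ereal (y' \<bullet> (c *\<^sub>R b)))"
    using assms(1) by (intro SUP_upper) (auto simp: regret_minimizer_def)
  then have "0 \<le> regret Y (play R L) L 1"
    unfolding regret_def by (simp add: L_def play_def ereal_le_minus_iff)
  also have "\<dots> \<le> ereal (A + B * (\<Sum>t=1..1. (infnorm (L t - L (t - 1)))\<^sup>2))"
    using assms(2) unfolding predictive_def by (metis L_def)
  also have "\<dots> = ereal (A + B * (infnorm (c *\<^sub>R b))\<^sup>2)"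
    by (simp add: L_def)
  finally show False
    using neg by simp
qed

lemma bounded_utilities_nonneg: "bounded_utilities M l \<Longrightarrow> 0 \<le> M"
  unfolding bounded_utilities_def using infnorm_pos_le order_trans by blast

text \<open>Time 0 is included because the variation at time 1 refers to \<open>l 0\<close>; there
  the bound reads \<open>0 \<le> M\<close>.\<close>

lemma bounded_utilities_infnorm_le: "bounded_utilities M l \<Longrightarrow> infnorm (l t) \<le> M"
  using bounded_utilities_nonneg[of M l]
  by (cases "t = 0") (auto simp: bounded_utilities_def infnorm_0)

text \<open>The analysis, detached from the construction: \<open>x\<close> is any sequence of
  approximate fixed points of the transformations that \<open>R\<close> chooses in response to
  \<open>x\<close> itself.\<close>

lemma phi_regret_le:
  fixes l :: "nat \<Rightarrow> real ^ 'n"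
  assumes l: "bounded_utilities M l"
    and R: "regret_minimizer \<Phi> R" "predictive \<Phi> A B R"
    and x: "\<And>t. infnorm (x t) \<le> 1"
    and fixed: "\<And>t. 1 \<le> t \<Longrightarrow> l1norm (transformations R x l t *v x t - x t) \<le> \<epsilon> t"
  shows "phi_regret \<Phi> x l T \<le> ereal (A
          + 2 * B * (\<Sum>t=1..T. (infnorm (l t - l (t - 1)))\<^sup>2)
          + 2 * B * M\<^sup>2 * (\<Sum>t=1..T. (infnorm (x t - x (t - 1)))\<^sup>2)
          + M * (\<Sum>t=1..T. \<epsilon> t))"
proof -
  define U where "U t = utility_matrix (x t) (l t)" for t
  define \<phi> where "\<phi> = transformations R x l"
  define S where "S = (SUP \<psi>\<in>\<Phi>. ereal (\<Sum>t=1..T. (\<psi> *v x t) \<bullet> l t))"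
  define V where "V = (\<Sum>t=1..T. (infnorm (U t - U (t - 1)))\<^sup>2)"
  define a where "a = (\<Sum>t=1..T. (infnorm (l t - l (t - 1)))\<^sup>2)"
  define b where "b = (\<Sum>t=1..T. (infnorm (x t - x (t - 1)))\<^sup>2)"
  have inner_U: "\<psi> \<bullet> U t = (\<psi> *v x t) \<bullet> l t" for \<psi> t
    by (simp add: U_def inner_utility_matrix)
  \<comment> \<open>Predictivity speaks only of utilities starting at 0. Here this comes from
    \<open>l 0 = 0\<close>, whatever \<open>x 0\<close> is.\<close>
  have "U 0 = 0"
    using l by (simp add: U_def utility_matrix_def bounded_utilities_def vec_eq_iff)
  then have "regret \<Phi> (play R U) U T \<le> ereal (A + B * V)"
    using R(2) unfolding predictive_def V_def by blast
  then have "S - ereal (\<Sum>t=1..T. (\<phi> t *v x t) \<bullet> l t) \<le> ereal (A + B * V)"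
    by (simp add: regret_def S_def \<phi>_def inner_U transformations_def flip: U_def)
  \<comment> \<open>\<open>S\<close> is an extended real. With the finite sum moved to the right,
    all further estimates concern real numbers.\<close>
  then have S: "S \<le> ereal (A + B * V + (\<Sum>t=1..T. (\<phi> t *v x t) \<bullet> l t))"
    by (simp add: ereal_minus_le)
  have "(\<phi> t *v x t) \<bullet> l t - x t \<bullet> l t \<le> M * \<epsilon> t" if "1 \<le> t" for t
  proof -
    have "(\<phi> t *v x t) \<bullet> l t - x t \<bullet> l t \<le> l1norm (\<phi> t *v x t - x t) * infnorm (l t)"
      using inner_le_l1norm_infnorm by (simp flip: inner_diff_left)
    \<comment> \<open>Monotonicity of the product needs \<open>0 \<le> \<epsilon> t\<close>, which
      holds because \<open>\<epsilon> t\<close> bounds a norm.\<close>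
    also have "\<dots> \<le> \<epsilon> t * M"
      using fixed[OF that] l1norm_nonneg[of "\<phi> t *v x t - x t"]
      by (intro mult_mono bounded_utilities_infnorm_le[OF l] infnorm_pos_le) (auto simp: \<phi>_def)
    finally show ?thesis by (simp add: mult.commute)
  qed
  then have err: "(\<Sum>t=1..T. (\<phi> t *v x t) \<bullet> l t) - (\<Sum>t=1..T. x t \<bullet> l t) \<le> M * (\<Sum>t=1..T. \<epsilon> t)"
    unfolding sum_distrib_left sum_subtractf[symmetric] by (intro sum_mono) auto
  have "V \<le> (\<Sum>t=1..T. 2 * (infnorm (l t - l (t - 1)))\<^sup>2
      + 2 * M\<^sup>2 * (infnorm (x t - x (t - 1)))\<^sup>2)"
    unfolding V_def U_def
    by (intro sum_mono infnorm_utility_matrix_diff_squared_le x bounded_utilities_infnorm_le[OF l])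
  also have "\<dots> = 2 * a + 2 * M\<^sup>2 * b"
    by (simp add: a_def b_def sum.distrib sum_distrib_left)
  \<comment> \<open>The sign of \<open>B\<close> is no hypothesis; it follows from
    predictivity.\<close>
  finally have "B * V \<le> B * (2 * a + 2 * M\<^sup>2 * b)"
    using predictive_imp_nonneg[OF R] by (rule mult_left_mono)
  with err have "A + B * V + (\<Sum>t=1..T. (\<phi> t *v x t) \<bullet> l t)
      \<le> A + 2 * B * a + 2 * B * M\<^sup>2 * b + M * (\<Sum>t=1..T. \<epsilon> t) + (\<Sum>t=1..T. x t \<bullet> l t)"
    by (simp add: algebra_simps)
  with S have "S \<le> ereal (A + 2 * B * a + 2 * B * M\<^sup>2 * b + M * (\<Sum>t=1..T. \<epsilon> t)
      + (\<Sum>t=1..T. x t \<bullet> l t))"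
    by (meson ereal_less_eq(3) order_trans)
  then show ?thesis
    by (simp add: phi_regret_def S_def a_def b_def ereal_minus_le)
qed

text \<open>The matrix fed to \<open>R\<close> depends on the algorithm's own last output. The state
  of the fold therefore carries that output together with all matrices fed so far.\<close>

definition oracle_step ::
  "(real ^ 'n ^ 'n, real ^ 'n ^ 'n) online
     \<Rightarrow> (real ^ 'n ^ 'n \<Rightarrow> real ^ 'n \<Rightarrow> real \<Rightarrow> real \<Rightarrow> real ^ 'n) \<Rightarrow> real \<Rightarrow> (nat \<Rightarrow> real)
     \<Rightarrow> (real ^ 'n) \<times> (real ^ 'n ^ 'n) list \<Rightarrow> real ^ 'n \<Rightarrow> (real ^ 'n) \<times> (real ^ 'n ^ 'n) list" where
  "oracle_step R orc \<kappa> \<epsilon> p l =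
     (let us = snd p @ [utility_matrix (fst p) l]
      in (orc (R us) (fst p) \<kappa> (\<epsilon> (length us + 1)), us))"

definition oracle_alg ::
  "(real ^ 'n ^ 'n, real ^ 'n ^ 'n) online
     \<Rightarrow> (real ^ 'n ^ 'n \<Rightarrow> real ^ 'n \<Rightarrow> real \<Rightarrow> real \<Rightarrow> real ^ 'n)
     \<Rightarrow> real ^ 'n \<Rightarrow> real \<Rightarrow> (nat \<Rightarrow> real) \<Rightarrow> (real ^ 'n, real ^ 'n) online" where
  "oracle_alg R orc x1 \<kappa> \<epsilon> h = fst (foldl (oracle_step R orc \<kappa> \<epsilon>) (x1, []) h)"

lemma snd_oracle_step:
  "snd (oracle_step R orc \<kappa> \<epsilon> p l) = snd p @ [utility_matrix (fst p) l]"
  by (simp add: oracle_step_def Let_def)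

text \<open>Invariant: for \<open>t \<ge> 1\<close>, the state after the utilities of times 1 to
  \<open>t - 1\<close> consists of \<open>x t\<close> and the matrices of these times, which is the
  history that determines \<open>transformations R x l t\<close>.\<close>

lemma oracle_run_oracle_alg: "oracle_run R orc x1 \<kappa> \<epsilon> l (play (oracle_alg R orc x1 \<kappa> \<epsilon>) l)"
proof -
  define x where "x = play (oracle_alg R orc x1 \<kappa> \<epsilon>) l"
  let ?state = "\<lambda>t. foldl (oracle_step R orc \<kappa> \<epsilon>) (x1, []) (map l [1..<t])"
  let ?us = "\<lambda>t. map (\<lambda>s. utility_matrix (x s) (l s)) [1..<t]"
  have x: "x t = fst (?state t)" for t
    by (simp add: x_def play_def oracle_alg_def)
  \<comment> \<open>At \<open>t = 0\<close> this would fail: both \<open>[1..<0]\<close> and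
    \<open>[1..<1]\<close> are empty, so no step is taken.\<close>
  have step: "?state (Suc t) = oracle_step R orc \<kappa> \<epsilon> (?state t) (l t)" if "1 \<le> t" for t
    using that by simp
  have snd: "snd (?state t) = ?us t" if "1 \<le> t" for t
    using that
  proof (induction t rule: dec_induct)
    case (step t)
    then show ?case
      by (simp add: snd_oracle_step x)
  qed simp
  have "x t = orc (transformations R x l t) (x (t - 1)) \<kappa> (\<epsilon> t)" if t2: "2 \<le> t" for t
  proof -
    obtain s where t: "t = Suc s" "1 \<le> s"
      using t2 by (cases t) auto
    have "?state s = (x s, ?us s)"
      using snd[OF t(2)] by (simp add: x prod_eq_iff del: upt_Suc)
    \<comment> \<open>The extended list has length \<open>s\<close>, so the error index used by the
      step is \<open>s + 1 = t\<close>.\<close>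
    then have "x t = orc (R (?us s @ [utility_matrix (x s) (l s)])) (x s) \<kappa> (\<epsilon> t)"
      unfolding t(1) x[of "Suc s"] step[OF t(2)] using t(2) by (simp add: oracle_step_def Let_def)
    then show ?thesis
      using t by (simp add: transformations_def play_def)
  qed
  moreover have "x 1 = x1"
    by (simp add: x)
  ultimately show ?thesis
    by (simp add: oracle_run_def x_def)
qed

theorem theorem3p2:
  fixes X :: "(real ^ 'n) set"
    and \<Phi> :: "(real ^ 'n ^ 'n) set"
    and R :: "(real ^ 'n ^ 'n, real ^ 'n ^ 'n) online"
    and orc :: "real ^ 'n ^ 'n \<Rightarrow> real ^ 'n \<Rightarrow> real \<Rightarrow> real \<Rightarrow> real ^ 'n"
    and x1 :: "real ^ 'n"
    and A B \<kappa> M :: real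
    and \<epsilon> :: "nat \<Rightarrow> real"
  assumes X: "convex X" "compact X" "\<And>x. x \<in> X \<Longrightarrow> infnorm x \<le> 1"
    and \<Phi>: "\<And>\<phi>. \<phi> \<in> \<Phi> \<Longrightarrow> (\<lambda>x. \<phi> *v x) ` X \<subseteq> X"
    and R: "regret_minimizer \<Phi> R" "predictive \<Phi> A B R"
    and stable: "\<And>L. bounded_utilities M L \<Longrightarrow> fixed_point_stable X l1norm \<kappa> (play R L)"
    and initial: "x1 \<in> X" "l1norm (R [] *v x1 - x1) \<le> \<epsilon> 1"
    and answers: "\<And>l x t. bounded_utilities M l \<Longrightarrow> oracle_run R orc x1 \<kappa> \<epsilon> l x \<Longrightarrow> t \<ge> 2 \<Longrightarrow>
      oracle_answer X (transformations R x l t) (x (t - 1)) \<kappa> (\<epsilon> t) (x t)"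
  shows "\<exists>alg :: (real ^ 'n, real ^ 'n) online.
    regret_minimizer X alg \<and>
    (\<forall>l. bounded_utilities M l \<longrightarrow>
      oracle_run R orc x1 \<kappa> \<epsilon> l (play alg l) \<and>
      (\<forall>t\<ge>2. l1norm (play alg l t - play alg l (t - 1)) \<le> \<kappa>) \<and>
      (\<forall>T. phi_regret \<Phi> (play alg l) l T \<le> ereal (A
          + 2 * B * (\<Sum>t=1..T. (infnorm (l t - l (t - 1)))\<^sup>2)
          + 2 * B * M\<^sup>2 * (\<Sum>t=1..T. (infnorm (play alg l t - play alg l (t - 1)))\<^sup>2)
          + M * (\<Sum>t=1..T. \<epsilon> t))))"
proof -
  let ?raw = "oracle_alg R orc x1 \<kappa> \<epsilon>"
  \<comment> \<open>Off the bounded utilities the oracle may answer outside \<open>X\<close>.\<close>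
  define alg where "alg h = (if ?raw h \<in> X then ?raw h else x1)" for h
  have "regret_minimizer X alg"
    using initial(1) by (simp add: regret_minimizer_def alg_def)
  moreover have "oracle_run R orc x1 \<kappa> \<epsilon> l (play alg l) \<and>
      (\<forall>t\<ge>2. l1norm (play alg l t - play alg l (t - 1)) \<le> \<kappa>) \<and>
      (\<forall>T. phi_regret \<Phi> (play alg l) l T \<le> ereal (A
          + 2 * B * (\<Sum>t=1..T. (infnorm (l t - l (t - 1)))\<^sup>2)
          + 2 * B * M\<^sup>2 * (\<Sum>t=1..T. (infnorm (play alg l t - play alg l (t - 1)))\<^sup>2)
          + M * (\<Sum>t=1..T. \<epsilon> t)))"
    if l: "bounded_utilities M l" for l
  proof -
    define x where "x = play ?raw l"
    have run: "oracle_run R orc x1 \<kappa> \<epsilon> l x"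
      unfolding x_def by (rule oracle_run_oracle_alg)
    have answer: "oracle_answer X (transformations R x l t) (x (t - 1)) \<kappa> (\<epsilon> t) (x t)"
      if "t \<ge> 2" for t
      using answers[OF l run that] .
    have x01: "x 0 = x1" "x 1 = x1"
      by (simp_all add: x_def play_def oracle_alg_def)
    \<comment> \<open>Oracle answers cover times from 2 on; times 0 and 1 both give
      \<open>x1\<close>.\<close>
    have xX: "x t \<in> X" for t
    proof -
      consider "t = 0" | "t = 1" | "t \<ge> 2" by linarith
      then show ?thesis
        using x01 initial(1) answer[of t] by cases (auto simp: oracle_answer_def)
    qed
    \<comment> \<open>As the raw outputs stay in \<open>X\<close>, the fallback to \<open>x1\<close>
      never triggers, and everything shown for \<open>x\<close> transfers to
      \<open>alg\<close>.\<close>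
    have alg: "play alg l = x"
    proof
      fix t
      show "play alg l t = x t"
        using xX[of t] by (simp add: x_def play_def alg_def)
    qed
    have "l1norm (transformations R x l t *v x t - x t) \<le> \<epsilon> t" if "1 \<le> t" for t
    \<comment> \<open>At time 1 nothing has been observed, so the transformation is
      \<open>R []\<close> and the assumption on \<open>x1\<close> applies.\<close>
    proof (cases "t = 1")
      case True
      then show ?thesis
        using initial(2) x01(2) by (simp add: transformations_def play_def)
    next
      case False
      then show ?thesis
        using that answer[of t] by (simp add: oracle_answer_def)
    qed
    note phi_regret_le[OF l R X(3)[OF xX] this]
    then show ?thesis
      using run answer unfolding alg by (auto simp: oracle_answer_def)
  qed
  ultimately show ?thesis
    by blast
qed

end
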